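(* Let $A$ be a Banach algebra with an approximate identity bounded by one. Then: (i) if $X$ is a left introverted subspace of $A^*$ with $X\subseteq A^*\cdot A$, then $\mathcal{H}_r(X)\cong X^*$; (ii) if $X$ is a right introverted subspace of $A^*$ with $X\subseteq A\cdot A^*$, then $\mathcal{H}_\ell(X)\cong X^*$; (iii) $\mathcal{H}_r(A^* )\cong (A^*\cdot A)^*\cong\mathcal{H}_r(A^*\cdot A)$ and $\mathcal{H}_\ell(A^* )\cong (A\cdot A^* )^*\cong\mathcal{H}_\ell(A\cdot A^* )$. Here $\cong$ denotes isometric algebra isomorphism.
   Context: For $\omega\in A$, $x\in A^*$ define $x\cdot\omega,\ \omega\cdot x\in A^*$ by $(x\cdot\omega)(\nu)=x(\omega\nu)$, $(\omega\cdot x)(\nu)=x(\nu\omega)$ ($\nu\in A$). Put $A^*\cdot A=\{x\cdot\omega: x\in A^*,\omega\in A\}$ and $A\cdot A^*=\{\omega\cdot x: x\in A^*,\omega\in A\}$; when $A$ has a bounded approximate identity these are closed linear subspaces of $A^*$ (Cohen factorization), and they are respectively left and right introverted in the sense below. Left introverted: a closed subspace $X$ of $A^*$ with $X\cdot A\subseteq X$ such that for all $m\in X^*$, $x\in X$ the functional $m\odot x\in A^*$, $(m\odot x)(\omega)=m(x\cdot\omega)$, lies in $X$. Then $X^*$ is a Banach algebra under $(m\odot n)(x)=m(n\odot x)$. Right introverted: a closed subspace $X$ of $A^*$ with $A\cdot X\subseteq X$ such that for all $m\in X^*$, $x\in X$ the functional $x\diamond m\in A^*$, $(x\diamond m)(\omega)=m(\omega\cdot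 x)$, lies in $X$. Then $X^*$ is a Banach algebra under $(m\diamond n)(x)=n(x\diamond m)$. For a closed subspace $X$ of $A^*$ with $X\cdot A\subseteq X$, $\mathcal{H}_r(X)$ is the set of bounded linear $T:X\to X$ with $T(x\cdot\omega)=T(x)\cdot\omega$ for all $x\in X,\omega\in A$, with operator norm and composition $(ST)(x)=S(T(x))$ as product. If $A\cdot X\subseteq X$, $\mathcal{H}_\ell(X)$ is the set of bounded linear $T:X\to X$ with $T(\omega\cdot x)=\omega\cdot T(x)$ for all $x\in X,\omega\in A$, with operator norm; left-module maps are regarded as acting on the right, i.e. the product $ST$ in $\mathcal{H}_\ell(X)$ is the map $x\mapsto T(S(x))$. *)

theory Defs
  imports "HOL-Analysis.Analysis"
begin

text \<open>
  The class \<open>real_normed_algebra\<close> only provides real scalars, so the scalar multiplication of the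
  Banach algebra over \<open>'k\<close> is an explicit parameter. A complete \<open>real_normed_field\<close> is (up to
  isometric isomorphism) the reals or the complex numbers, so leaving \<open>'k\<close> arbitrary covers
  exactly real and complex Banach algebras. The algebra need not have a unit.
\<close>

locale banach_algebra_over = vector_space scl
  for scl :: "'k::{real_normed_field,banach} \<Rightarrow> 'a::{real_normed_algebra,banach} \<Rightarrow> 'a" +
  assumes scale_of_real: "scl (of_real r) a = r *\<^sub>R a"
    and norm_scale: "norm (scl c a) = norm c * norm a"
    and scale_mult_left: "scl c a * b = scl c (a * b)"
    and scale_mult_right: "a * scl c b = scl c (a * b)"

text \<open>Nets are rendered as families converging along a proper filter.\<close>

definition approx_identity_bounded_by_one ::
    "('i \<Rightarrow> 'a::real_normed_algebra) \<Rightarrow> 'i filter \<Rightarrow> bool" where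
  "approx_identity_bounded_by_one e F \<longleftrightarrow>
     F \<noteq> bot \<and> (\<forall>i. norm (e i) \<le> 1) \<and>
     (\<forall>a. ((\<lambda>i. e i * a) \<longlongrightarrow> a) F) \<and> (\<forall>a. ((\<lambda>i. a * e i) \<longlongrightarrow> a) F)"


subsection \<open>The dual space and its module actions\<close>

text \<open>
  \<open>'a \<Rightarrow>\<^sub>L 'k\<close> consists of the bounded real-linear maps with the operator norm;
  \<open>A\<^sup>*\<close> is its closed subspace of \<open>'k\<close>-linear maps.
\<close>

definition dual_space ::
    "('k::{real_normed_field,banach} \<Rightarrow> 'a::{real_normed_algebra,banach} \<Rightarrow> 'a) \<Rightarrow> ('a \<Rightarrow>\<^sub>L 'k) set" where
  "dual_space scl = {x. \<forall>c a. blinfun_apply x (scl c a) = c * blinfun_apply x a}"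

lift_definition dual_scale ::
    "'k::real_normed_field \<Rightarrow> ('a::real_normed_vector \<Rightarrow>\<^sub>L 'k) \<Rightarrow> ('a \<Rightarrow>\<^sub>L 'k)"
  is "\<lambda>c x a. c * x a"
  by (rule bounded_linear_const_mult)

lift_definition dual_ract ::
    "('a::real_normed_algebra \<Rightarrow>\<^sub>L 'k::real_normed_vector) \<Rightarrow> 'a \<Rightarrow> ('a \<Rightarrow>\<^sub>L 'k)" (infixl "\<cdot>\<^sub>r" 70)
  is "\<lambda>x w v. x (w * v)"
  by (rule bounded_linear_compose[OF _ bounded_linear_mult_right])

lift_definition dual_lact ::
    "'a::real_normed_algebra \<Rightarrow> ('a \<Rightarrow>\<^sub>L 'k::real_normed_vector) \<Rightarrow> ('a \<Rightarrow>\<^sub>L 'k)" (infixr "\<cdot>\<^sub>l" 70)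
  is "\<lambda>w x v. x (v * w)"
  by (rule bounded_linear_compose[OF _ bounded_linear_mult_left])

global_interpretation dual: vector_space
  "dual_scale :: 'k::real_normed_field \<Rightarrow> ('a::real_normed_vector \<Rightarrow>\<^sub>L 'k) \<Rightarrow> ('a \<Rightarrow>\<^sub>L 'k)"
  by standard (transfer; simp add: fun_eq_iff algebra_simps)+

definition dual_dot_alg ::
    "('k::{real_normed_field,banach} \<Rightarrow> 'a::{real_normed_algebra,banach} \<Rightarrow> 'a) \<Rightarrow> ('a \<Rightarrow>\<^sub>L 'k) set" where
  "dual_dot_alg scl = {x \<cdot>\<^sub>r w | x w. x \<in> dual_space scl}"

definition alg_dot_dual ::
    "('k::{real_normed_field,banach} \<Rightarrow> 'a::{real_normed_algebra,banach} \<Rightarrow> 'a) \<Rightarrow> ('a \<Rightarrow>\<^sub>L 'k) set" where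
  "alg_dot_dual scl = {w \<cdot>\<^sub>l x | w x. x \<in> dual_space scl}"


subsection \<open>Functionals and operators on a subspace of the dual\<close>

text \<open>
  Maps defined on a subspace \<open>X\<close> are represented by functions in \<open>extensional X\<close>, so that they are
  determined by their values on \<open>X\<close>. In \<open>bounded_linear_over\<close>, \<open>s\<close> is the scalar multiplication
  of the target space. The norm mirrors \<^const>\<open>onorm\<close>.
\<close>

definition bounded_linear_over ::
    "('k \<Rightarrow> 'b \<Rightarrow> 'b) \<Rightarrow> ('a::real_normed_vector \<Rightarrow>\<^sub>L 'k::real_normed_field) set \<Rightarrow>
     (('a \<Rightarrow>\<^sub>L 'k) \<Rightarrow> 'b::real_normed_vector) \<Rightarrow> bool" where
  "bounded_linear_over s X f \<longleftrightarrow>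
     (\<forall>x\<in>X. \<forall>y\<in>X. f (x + y) = f x + f y) \<and>
     (\<forall>c. \<forall>x\<in>X. f (dual_scale c x) = s c (f x)) \<and>
     (\<exists>K. \<forall>x\<in>X. norm (f x) \<le> K * norm x)"

definition onorm_on :: "'b::real_normed_vector set \<Rightarrow> ('b \<Rightarrow> 'c::real_normed_vector) \<Rightarrow> real" where
  "onorm_on X f = (SUP x\<in>X. norm (f x) / norm x)"

definition functionals ::
    "('a::real_normed_vector \<Rightarrow>\<^sub>L 'k::real_normed_field) set \<Rightarrow> (('a \<Rightarrow>\<^sub>L 'k) \<Rightarrow> 'k) set" where
  "functionals X = {m \<in> extensional X. bounded_linear_over (*) X m}"

definition right_module_maps ::
    "('a::real_normed_algebra \<Rightarrow>\<^sub>L 'k::real_normed_field) set \<Rightarrow> (('a \<Rightarrow>\<^sub>L 'k) \<Rightarrow> ('a \<Rightarrow>\<^sub>L 'k)) set" where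
  "right_module_maps X =
     {T \<in> X \<rightarrow>\<^sub>E X. bounded_linear_over dual_scale X T \<and> (\<forall>x\<in>X. \<forall>w. T (x \<cdot>\<^sub>r w) = T x \<cdot>\<^sub>r w)}"

definition left_module_maps ::
    "('a::real_normed_algebra \<Rightarrow>\<^sub>L 'k::real_normed_field) set \<Rightarrow> (('a \<Rightarrow>\<^sub>L 'k) \<Rightarrow> ('a \<Rightarrow>\<^sub>L 'k)) set" where
  "left_module_maps X =
     {T \<in> X \<rightarrow>\<^sub>E X. bounded_linear_over dual_scale X T \<and> (\<forall>x\<in>X. \<forall>w. T (w \<cdot>\<^sub>l x) = w \<cdot>\<^sub>l T x)}"


subsection \<open>Introverted subspaces\<close>

definition functional_odot ::
    "(('a::real_normed_algebra \<Rightarrow>\<^sub>L 'k::real_normed_field) \<Rightarrow> 'k) \<Rightarrow> ('a \<Rightarrow>\<^sub>L 'k) \<Rightarrow> ('a \<Rightarrow>\<^sub>L 'k)"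
    (infixr "\<odot>" 70) where
  "m \<odot> x = Blinfun (\<lambda>w. m (x \<cdot>\<^sub>r w))"

definition functional_diamond ::
    "('a::real_normed_algebra \<Rightarrow>\<^sub>L 'k::real_normed_field) \<Rightarrow> (('a \<Rightarrow>\<^sub>L 'k) \<Rightarrow> 'k) \<Rightarrow> ('a \<Rightarrow>\<^sub>L 'k)"
    (infixl "\<diamond>" 70) where
  "x \<diamond> m = Blinfun (\<lambda>w. m (w \<cdot>\<^sub>l x))"

text \<open>\<^const>\<open>Blinfun\<close> is only meaningful on bounded linear maps; that is the case where it is used.\<close>

lemma dual_ract_bounded_linear: "bounded_linear (\<lambda>w. x \<cdot>\<^sub>r w)"
proof (rule bounded_linear_intro[where K = "norm x"])
  show "norm (x \<cdot>\<^sub>r w) \<le> norm w * norm x" for w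
  proof (rule norm_blinfun_bound)
    show "norm (blinfun_apply (x \<cdot>\<^sub>r w) v) \<le> norm w * norm x * norm v" for v
      using norm_blinfun[of x "w * v"] mult_left_mono[OF norm_mult_ineq[of w v] norm_ge_zero[of x]]
      by (simp add: dual_ract.rep_eq mult_ac)
  qed simp
qed (rule blinfun_eqI; simp add: dual_ract.rep_eq blinfun.bilinear_simps distrib_right)+

lemma dual_lact_bounded_linear: "bounded_linear (\<lambda>w. w \<cdot>\<^sub>l x)"
proof (rule bounded_linear_intro[where K = "norm x"])
  show "norm (w \<cdot>\<^sub>l x) \<le> norm w * norm x" for w
  proof (rule norm_blinfun_bound)
    show "norm (blinfun_apply (w \<cdot>\<^sub>l x) v) \<le> norm w * norm x * norm v" for v
      using norm_blinfun[of x "v * w"] mult_left_mono[OF norm_mult_ineq[of v w] norm_ge_zero[of x]]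
      by (simp add: dual_lact.rep_eq mult_ac)
  qed simp
qed (rule blinfun_eqI; simp add: dual_lact.rep_eq blinfun.bilinear_simps distrib_left)+

lemma functional_compose_bounded_linear:
  assumes m: "m \<in> functionals X" and h: "bounded_linear h" and hX: "\<And>w. h w \<in> X"
  shows "bounded_linear (\<lambda>w. m (h w))"
proof -
  interpret h: bounded_linear h by fact
  from m obtain K where K: "\<And>x. x \<in> X \<Longrightarrow> norm (m x) \<le> K * norm x"
    unfolding functionals_def bounded_linear_over_def by blast
  obtain L where L: "\<And>w. norm (h w) \<le> norm w * L" using h.bounded by blast
  have r: "r *\<^sub>R x = dual_scale (of_real r) x" for r and x :: "'a \<Rightarrow>\<^sub>L 'b"
    by (rule blinfun_eqI) (simp add: dual_scale.rep_eq scaleR_blinfun.rep_eq scaleR_conv_of_real)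
  show ?thesis
  proof (rule bounded_linear_intro[where K = "\<bar>K\<bar> * L"])
    fix v w r
    show "m (h (v + w)) = m (h v) + m (h w)" "m (h (r *\<^sub>R w)) = r *\<^sub>R m (h w)"
      using m hX unfolding h.add h.scaleR r
      by (auto simp: functionals_def bounded_linear_over_def scaleR_conv_of_real)
    have "norm (m (h w)) \<le> \<bar>K\<bar> * norm (h w)"
      using K[OF hX[of w]] mult_right_mono[OF abs_ge_self[of K] norm_ge_zero[of "h w"]] by linarith
    also have "\<dots> \<le> norm w * (\<bar>K\<bar> * L)"
      using mult_left_mono[OF L[of w] abs_ge_zero[of K]] by (simp add: mult_ac)
    finally show "norm (m (h w)) \<le> norm w * (\<bar>K\<bar> * L)" .
  qed
qed

lemma functional_odot_apply:
  assumes "m \<in> functionals X" "\<And>w. x \<cdot>\<^sub>r w \<in> X"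
  shows "blinfun_apply (m \<odot> x) w = m (x \<cdot>\<^sub>r w)"
  unfolding functional_odot_def
  by (subst bounded_linear_Blinfun_apply)
    (auto intro: functional_compose_bounded_linear[OF assms(1) dual_ract_bounded_linear assms(2)])

lemma functional_diamond_apply:
  assumes "m \<in> functionals X" "\<And>w. w \<cdot>\<^sub>l x \<in> X"
  shows "blinfun_apply (x \<diamond> m) w = m (w \<cdot>\<^sub>l x)"
  unfolding functional_diamond_def
  by (subst bounded_linear_Blinfun_apply)
    (auto intro: functional_compose_bounded_linear[OF assms(1) dual_lact_bounded_linear assms(2)])

definition left_introverted ::
    "('k::{real_normed_field,banach} \<Rightarrow> 'a::{real_normed_algebra,banach} \<Rightarrow> 'a) \<Rightarrow>
     ('a \<Rightarrow>\<^sub>L 'k) set \<Rightarrow> bool" where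
  "left_introverted scl X \<longleftrightarrow>
     X \<subseteq> dual_space scl \<and> dual.subspace X \<and> closed X \<and>
     (\<forall>x\<in>X. \<forall>w. x \<cdot>\<^sub>r w \<in> X) \<and> (\<forall>m\<in>functionals X. \<forall>x\<in>X. m \<odot> x \<in> X)"

definition right_introverted ::
    "('k::{real_normed_field,banach} \<Rightarrow> 'a::{real_normed_algebra,banach} \<Rightarrow> 'a) \<Rightarrow>
     ('a \<Rightarrow>\<^sub>L 'k) set \<Rightarrow> bool" where
  "right_introverted scl X \<longleftrightarrow>
     X \<subseteq> dual_space scl \<and> dual.subspace X \<and> closed X \<and>
     (\<forall>x\<in>X. \<forall>w. w \<cdot>\<^sub>l x \<in> X) \<and> (\<forall>m\<in>functionals X. \<forall>x\<in>X. x \<diamond> m \<in> X)"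


subsection \<open>Normed algebras with carrier, and isometric isomorphism\<close>

record ('k, 'b) normed_alg =
  car :: "'b set"
  add :: "'b \<Rightarrow> 'b \<Rightarrow> 'b"
  smul :: "'k \<Rightarrow> 'b \<Rightarrow> 'b"
  mul :: "'b \<Rightarrow> 'b \<Rightarrow> 'b"
  nrm :: "'b \<Rightarrow> real"

definition isometric_alg_iso ::
    "('k, 'b) normed_alg \<Rightarrow> ('k, 'c) normed_alg \<Rightarrow> bool" (infix "\<cong>\<^sub>i" 50) where
  "P \<cong>\<^sub>i Q \<longleftrightarrow> (\<exists>\<phi>. bij_betw \<phi> (car P) (car Q) \<and>
     (\<forall>a\<in>car P. \<forall>b\<in>car P. \<phi> (add P a b) = add Q (\<phi> a) (\<phi> b)) \<and>
     (\<forall>c. \<forall>a\<in>car P. \<phi> (smul P c a) = smul Q c (\<phi> a)) \<and>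
     (\<forall>a\<in>car P. \<forall>b\<in>car P. \<phi> (mul P a b) = mul Q (\<phi> a) (\<phi> b)) \<and>
     (\<forall>a\<in>car P. nrm Q (\<phi> a) = nrm P a))"

definition left_dual_alg ::
    "('a::real_normed_algebra \<Rightarrow>\<^sub>L 'k::real_normed_field) set \<Rightarrow> ('k, ('a \<Rightarrow>\<^sub>L 'k) \<Rightarrow> 'k) normed_alg" where
  "left_dual_alg X =
     \<lparr> car = functionals X,
       add = (\<lambda>m n. \<lambda>x\<in>X. m x + n x),
       smul = (\<lambda>c m. \<lambda>x\<in>X. c * m x),
       mul = (\<lambda>m n. \<lambda>x\<in>X. m (n \<odot> x)),
       nrm = onorm_on X \<rparr>"

definition right_dual_alg ::
    "('a::real_normed_algebra \<Rightarrow>\<^sub>L 'k::real_normed_field) set \<Rightarrow> ('k, ('a \<Rightarrow>\<^sub>L 'k) \<Rightarrow> 'k) normed_alg" where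
  "right_dual_alg X =
     \<lparr> car = functionals X,
       add = (\<lambda>m n. \<lambda>x\<in>X. m x + n x),
       smul = (\<lambda>c m. \<lambda>x\<in>X. c * m x),
       mul = (\<lambda>m n. \<lambda>x\<in>X. n (x \<diamond> m)),
       nrm = onorm_on X \<rparr>"

definition Hr ::
    "('a::real_normed_algebra \<Rightarrow>\<^sub>L 'k::real_normed_field) set \<Rightarrow>
     ('k, ('a \<Rightarrow>\<^sub>L 'k) \<Rightarrow> ('a \<Rightarrow>\<^sub>L 'k)) normed_alg" where
  "Hr X =
     \<lparr> car = right_module_maps X,
       add = (\<lambda>S T. \<lambda>x\<in>X. S x + T x),
       smul = (\<lambda>c T. \<lambda>x\<in>X. dual_scale c (T x)),
       mul = (\<lambda>S T. \<lambda>x\<in>X. S (T x)),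
       nrm = onorm_on X \<rparr>"

text \<open>Left module maps act on the right, hence the reversed composition.\<close>

definition Hl ::
    "('a::real_normed_algebra \<Rightarrow>\<^sub>L 'k::real_normed_field) set \<Rightarrow>
     ('k, ('a \<Rightarrow>\<^sub>L 'k) \<Rightarrow> ('a \<Rightarrow>\<^sub>L 'k)) normed_alg" where
  "Hl X =
     \<lparr> car = left_module_maps X,
       add = (\<lambda>S T. \<lambda>x\<in>X. S x + T x),
       smul = (\<lambda>c T. \<lambda>x\<in>X. dual_scale c (T x)),
       mul = (\<lambda>S T. \<lambda>x\<in>X. T (S x)),
       nrm = onorm_on X \<rparr>"

end

theory Submission
  imports Defs
begin

text \<open>
  Every \<open>z = y \<cdot>\<^sub>r a\<close> in \<open>A\<^sup>* \<cdot> A\<close> has a value at the approximate identity, namely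
  \<open>lim z(e\<^sub>i) = lim y(a e\<^sub>i) = y(a)\<close>, and this value is linear and contractive in \<open>z\<close>. A module map
  \<open>T\<close> therefore yields the functional \<open>x \<mapsto> lim (T x)(e\<^sub>i)\<close>, a functional \<open>m\<close> yields the module map
  \<open>x \<mapsto> m \<odot> x\<close>, and the two constructions are mutually inverse and both contractive. Module maps
  on \<open>A\<^sup>*\<close> send \<open>A\<^sup>* \<cdot> A\<close> to itself, so the same correspondence applies to them. That \<open>A\<^sup>* \<cdot> A\<close> is
  closed under addition is Cohen factorization: a common right factor \<open>a = a' c\<close>, \<open>b = b' c\<close> gives
  \<open>x \<cdot>\<^sub>r a + y \<cdot>\<^sub>r b = (x \<cdot>\<^sub>r a' + y \<cdot>\<^sub>r b') \<cdot>\<^sub>r c\<close>. Left module maps are the case of the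
  opposite product.
\<close>

subsection \<open>Cohen factorization\<close>

text \<open>A Neumann series in fixed-point form: \<open>W v = y\<close> says
  \<open>v = inv U (y - (W v - U v))\<close>, and the right side is a contraction with constant 1/2
  because \<open>M\<close> bounds the inverse of \<open>U\<close>. Absorbing half of
  \<open>norm v\<close> doubles the bound.\<close>

lemma perturbed_surj:
  fixes U W :: "'a::banach \<Rightarrow> 'a"
  assumes U: "linear U" "surj U" "\<And>v. norm v \<le> M * norm (U v)" and "M > 0" and W: "linear W"
    and close: "\<And>v. M * norm (W v - U v) \<le> norm v / 2"
  shows "surj W" "norm v \<le> 2 * M * norm (W v)"
proof -
  interpret U: linear U by fact
  interpret W: linear W by fact
  have Uinv: "U (inv U y) = y" for y
    using U(2) by (simp add: surj_f_inv_f)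
  show "surj W"
    unfolding surj_def
  proof
    fix y
    define f where "f v = inv U (y - (W v - U v))" for v
    have "dist (f v) (f v') \<le> 1 / 2 * dist v v'" for v v'
    proof -
      have "U (f v - f v') = - (W (v - v') - U (v - v'))"
        unfolding f_def U.diff W.diff Uinv by simp
      then have "norm (f v - f v') \<le> M * norm (W (v - v') - U (v - v'))"
        using U(3)[of "f v - f v'"] by (simp add: norm_minus_commute)
      also have "\<dots> \<le> norm (v - v') / 2" by (rule close)
      finally show ?thesis by (simp add: dist_norm)
    qed
    then obtain v where "f v = v"
      using banach_fix_type[of "1 / 2" f] by auto
    then have "U v = y - (W v - U v)"
      using Uinv[of "y - (W v - U v)"] by (simp add: f_def)
    then show "\<exists>v. y = W v"
      by (intro exI[of _ v]) (simp add: algebra_simps)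
  qed
  have "M * norm (U v) \<le> M * norm (W v) + M * norm (W v - U v)"
    using \<open>M > 0\<close> norm_triangle_ineq2[of "U v" "W v"]
    by (simp add: norm_minus_commute flip: distrib_left)
  then show "norm v \<le> 2 * M * norm (W v)"
    using U(3)[of v] close[of v] by linarith
qed

text \<open>The product is a parameter so that the flipped multiplication fits too; a left
  approximate identity then serves as the right one.\<close>

locale approx_unital_product = bounded_bilinear prod
  for prod :: "'a::banach \<Rightarrow> 'a \<Rightarrow> 'a" (infixl "\<star>" 70) +
  fixes e :: "'i \<Rightarrow> 'a" and F :: "'i filter"
  assumes assoc: "a \<star> b \<star> c = a \<star> (b \<star> c)"
    and norm_prod_le: "norm (a \<star> b) \<le> norm a * norm b"
    and F_nontrivial: "F \<noteq> bot"
    and norm_e_le: "norm (e i) \<le> 1"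
    and tendsto_prod_e: "((\<lambda>i. a \<star> e i) \<longlongrightarrow> a) F"
begin

text \<open>
  With \<open>c = 1/4\<close>, this is right multiplication by the element \<open>(1 - c)\<^sup>n + s\<close> of the unitization.
\<close>

definition unitized_rmult :: "nat \<Rightarrow> 'a \<Rightarrow> 'a \<Rightarrow> 'a" where
  "unitized_rmult n s v = (3/4)^n *\<^sub>R v + v \<star> s"

lemma linear_unitized_rmult: "linear (unitized_rmult n s)"
  by (rule linearI) (simp_all add: unitized_rmult_def add_left scaleR_left algebra_simps)

text \<open>The inequality contains injectivity and bounds the inverse by \<open>M\<close>; the
  bound is explicit because the next \<open>e i\<close> is chosen relative to it.\<close>

definition invertible_bound :: "nat \<Rightarrow> 'a \<Rightarrow> real \<Rightarrow> bool" where
  "invertible_bound n s M \<longleftrightarrow>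
     M > 0 \<and> surj (unitized_rmult n s) \<and> (\<forall>v. norm v \<le> M * norm (unitized_rmult n s v))"

lemma eventually_norm_diff_prod_e_le:
  assumes "\<epsilon> > 0"
  shows "\<forall>\<^sub>F i in F. norm (v - v \<star> e i) \<le> \<epsilon>"
proof -
  have "\<forall>\<^sub>F i in F. dist (v \<star> e i) v < \<epsilon>"
    using tendsto_prod_e assms by (rule tendstoD)
  then show ?thesis
    by eventually_elim (simp add: dist_norm norm_minus_commute)
qed

text \<open>
  The new operator factors as \<open>G\<close> after \<open>unitized_rmult n t\<close>, where \<open>G\<close> is right multiplication by
  \<open>3/4 + e i / 4\<close> and \<open>G t = s\<close>. As \<open>t\<close> is close to \<open>s\<close> when \<open>s \<star> e i\<close> is, the new bound does not
  depend on \<open>i\<close>.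
\<close>

lemma invertible_bound_step:
  assumes inv: "invertible_bound n s M" and small: "M * norm (s - s \<star> e i) \<le> 1"
  shows "invertible_bound (Suc n) (s + ((3/4)^n / 4) *\<^sub>R e i) (4 * M)"
proof -
  let ?s' = "s + ((3/4)^n / 4) *\<^sub>R e i"
  define G where "G v = v - (1/4) *\<^sub>R (v - v \<star> e i)" for v
  have linG: "linear G"
    by (rule linearI) (simp_all add: G_def add_left scaleR_left algebra_simps)
  have diff: "norm (v - v \<star> e i) \<le> 2 * norm v" for v
    using norm_triangle_ineq4[of v "v \<star> e i"] norm_prod_le[of v "e i"]
      mult_left_mono[OF norm_e_le[of i] norm_ge_zero[of v]] by simp
  \<comment> \<open>The weight 1/4 is chosen for this: a quarter of \<open>2 * norm v\<close> is
    just the perturbation of the identity that \<open>perturbed_surj\<close> tolerates.\<close>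
  have closeG: "1 * norm (G v - id v) \<le> norm v / 2" for v
    using diff[of v] by (simp add: G_def)
  note G = perturbed_surj[OF linear_id surj_id _ zero_less_one linG closeG, simplified]
  obtain t where t: "G t = s"
    using G(1) by (metis surj_def)
  have M: "M > 0" and U: "surj (unitized_rmult n s)"
    "\<And>v. norm v \<le> M * norm (unitized_rmult n s v)"
    using inv by (auto simp: invertible_bound_def)
  \<comment> \<open>Since \<open>G t = s\<close>, the argument on the right is
    \<open>s - G s\<close>, a quarter of the defect \<open>s - s \<star> e i\<close>.\<close>
  have "norm (t - s) \<le> 2 * norm (G (t - s))"
    by (rule G(2))
  also have "G (t - s) = (1/4) *\<^sub>R (s - s \<star> e i)"
    using t by (simp add: linear_diff[OF linG]) (simp add: G_def)
  finally have ts: "norm (t - s) \<le> norm (s - s \<star> e i) / 2"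
    by simp
  have closeW: "M * norm (unitized_rmult n t v - unitized_rmult n s v) \<le> norm v / 2" for v
  proof -
    have "unitized_rmult n t v - unitized_rmult n s v = v \<star> (t - s)"
      by (simp add: unitized_rmult_def diff_right)
    then have "M * norm (unitized_rmult n t v - unitized_rmult n s v) \<le> M * (norm v * norm (t - s))"
      using norm_prod_le[of v "t - s"] M by simp
    also have "\<dots> \<le> M * (norm v * (norm (s - s \<star> e i) / 2))"
      using ts M by (intro mult_left_mono) auto
    also have "\<dots> = norm v / 2 * (M * norm (s - s \<star> e i))" by simp
    also have "\<dots> \<le> norm v / 2 * 1"
      using small by (intro mult_left_mono) auto
    finally show ?thesis by simp
  qed
  note W = perturbed_surj[OF linear_unitized_rmult U M linear_unitized_rmult closeW]
  have comp: "unitized_rmult (Suc n) ?s' v = G (unitized_rmult n t v)" for v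
  proof -
    \<comment> \<open>By associativity the right multiplication \<open>G\<close> commutes with left
      multiplication by \<open>v\<close>.\<close>
    have "G (v \<star> t) = v \<star> s"
      unfolding t[symmetric] by (simp add: G_def diff_right scaleR_right assoc)
    then have "G (unitized_rmult n t v) = (3/4)^n *\<^sub>R G v + v \<star> s"
      by (simp add: unitized_rmult_def linear_add[OF linG] linear_cmul[OF linG])
    moreover have "(3/4)^n *\<^sub>R G v = (3/4)^Suc n *\<^sub>R v + ((3/4)^n / 4) *\<^sub>R (v \<star> e i)"
    proof -
      have "G v = (3/4) *\<^sub>R v + (1/4) *\<^sub>R (v \<star> e i)"
        using scaleR_diff_left[of 1 "1/4" v] by (simp add: G_def scaleR_diff_right)
      then show ?thesis
        by (simp add: scaleR_add_right mult.commute)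
    qed
    ultimately show ?thesis
      by (simp add: unitized_rmult_def add_right scaleR_right)
  qed
  have "unitized_rmult (Suc n) ?s' = G \<circ> unitized_rmult n t"
    using comp by auto
  then have "surj (unitized_rmult (Suc n) ?s')"
    using comp_surj[OF W(1) G(1)] by simp
  \<comment> \<open>One factor 2 pays for replacing \<open>s\<close> by \<open>t\<close>, the other
    for inverting \<open>G\<close>.\<close>
  moreover have "norm v \<le> 4 * M * norm (unitized_rmult (Suc n) ?s' v)" for v
  proof -
    have "norm v \<le> 2 * M * norm (unitized_rmult n t v)"
      by (rule W(2))
    also have "\<dots> \<le> 2 * M * (2 * norm (G (unitized_rmult n t v)))"
      using M G(2) by (intro mult_left_mono) auto
    finally show ?thesis by (simp add: comp)
  qed
  ultimately show ?thesis
    using M by (simp add: invertible_bound_def)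
qed

text \<open>Makes the preimages of \<open>z\<close> a Cauchy sequence. The new operator sends the
  difference of the preimages to \<open>((3/4)^n / 4) *\<^sub>R (z0 - z0 \<star> e i)\<close>, and
  the 4 in the bound \<open>4 * M\<close> cancels the quarter.\<close>

lemma inv_unitized_rmult_step:
  fixes z
  assumes inv: "invertible_bound n s M" and small: "M * norm (s - s \<star> e i) \<le> 1"
  defines "z0 \<equiv> inv (unitized_rmult n s) z"
  shows "norm (inv (unitized_rmult (Suc n) (s + ((3/4)^n / 4) *\<^sub>R e i)) z - z0)
    \<le> M * norm (z0 - z0 \<star> e i)"
proof -
  let ?s' = "s + ((3/4)^n / 4) *\<^sub>R e i"
  let ?U = "unitized_rmult n s" and ?U' = "unitized_rmult (Suc n) ?s'"
  have inv': "invertible_bound (Suc n) ?s' (4 * M)"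
    using inv small by (rule invertible_bound_step)
  have "?U z0 = z" "?U' (inv ?U' z) = z"
    using inv inv' by (auto simp: invertible_bound_def surj_f_inv_f z0_def)
  then have "?U' (inv ?U' z - z0) = ?U z0 - ?U' z0"
    by (simp add: linear_diff[OF linear_unitized_rmult])
  also have "\<dots> = ((3/4)^n / 4) *\<^sub>R (z0 - z0 \<star> e i)"
  proof -
    have "(3/4)^n *\<^sub>R z0 = (3/4)^Suc n *\<^sub>R z0 + ((3/4)^n / 4) *\<^sub>R z0"
      by (simp flip: scaleR_add_left)
    then show ?thesis
      by (simp add: unitized_rmult_def add_right scaleR_right scaleR_diff_right)
  qed
  finally have "norm (inv ?U' z - z0) \<le> 4 * M * norm (((3/4)^n / 4) *\<^sub>R (z0 - z0 \<star> e i))"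
    using inv' by (auto simp: invertible_bound_def dest: spec[of _ "inv ?U' z - z0"])
  also have "\<dots> = (3/4)^n * (M * norm (z0 - z0 \<star> e i))"
    by simp
  also have "\<dots> \<le> 1 * (M * norm (z0 - z0 \<star> e i))"
    using inv by (intro mult_right_mono power_le_one) (auto simp: invertible_bound_def)
  finally show ?thesis by simp
qed

text \<open>
  Cohen's factorization theorem: the operators \<open>unitized_rmult n s\<^sub>n\<close> are invertible, say
  with preimages \<open>z\<^sub>n\<close> of \<open>z\<close>; since \<open>s\<^sub>n\<close> and \<open>z\<^sub>n\<close> converge and the scalar part \<open>(3/4)\<^sup>n\<close> vanishes, \<open>z\<close> is
  the limit of \<open>z\<^sub>n \<star> s\<^sub>n\<close>.
\<close>

theorem finite_common_right_factor:
  assumes "finite B"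
  obtains a where "\<And>z. z \<in> B \<Longrightarrow> \<exists>z'. z = z' \<star> a"
proof -
  define U where "U = unitized_rmult"
  \<comment> \<open>The recursion runs over pairs of an element and a bound for the inverse of its
    operator; \<open>Q\<close> asks for geometrically small moves of the element and of every
    preimage.\<close>
  define P where "P n p \<longleftrightarrow> invertible_bound n (fst p) (snd p)" for n p
  define Q where "Q n p p' \<longleftrightarrow> norm (fst p' - fst p) \<le> (3/4)^n \<and>
    (\<forall>z\<in>B. norm (inv (U (Suc n) (fst p')) z - inv (U n (fst p)) z) \<le> (3/4)^n)" for n and p p' :: "'a \<times> real"
  \<comment> \<open>At stage 0 with element 0 the operator is the identity.\<close>
  have "invertible_bound 0 0 1"
    by (auto simp: invertible_bound_def unitized_rmult_def zero_right surj_def)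
  then have init: "\<exists>p. P 0 p"
    by (auto simp: P_def)
  have step: "\<exists>p'. P (Suc n) p' \<and> Q n p p'" if "P n p" for n p
  proof -
    obtain s M where p: "p = (s, M)" by force
    with that have inv: "invertible_bound n s M" and M: "M > 0"
      by (auto simp: P_def invertible_bound_def)
    \<comment> \<open>Finiteness of \<open>B\<close> lets a single index serve all preimages;
      dividing the tolerances by \<open>M\<close> offsets the factor \<open>M\<close> in the two
      step lemmas.\<close>
    have "\<forall>\<^sub>F i in F. norm (s - s \<star> e i) \<le> 1 / M \<and>
      (\<forall>z\<in>B. norm (inv (U n s) z - inv (U n s) z \<star> e i) \<le> (3/4)^n / M)"
      using M \<open>finite B\<close>
      by (intro eventually_conj eventually_ball_finite ballI eventually_norm_diff_prod_e_le) auto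
    then obtain i where i: "norm (s - s \<star> e i) \<le> 1 / M"
      "\<And>z. z \<in> B \<Longrightarrow> norm (inv (U n s) z - inv (U n s) z \<star> e i) \<le> (3/4)^n / M"
      using eventually_happens'[OF F_nontrivial] by blast
    have small: "M * norm (s - s \<star> e i) \<le> 1"
      using i(1) M by (simp add: field_simps)
    let ?s' = "s + ((3/4)^n / 4) *\<^sub>R e i"
    have "norm (?s' - s) \<le> (3/4)^n / 4 * 1"
      using mult_left_mono[OF norm_e_le[of i], of "(3/4)^n / 4"] by simp
    then have "norm (?s' - s) \<le> (3/4)^n"
      by (rule order_trans) simp
    moreover have "norm (inv (U (Suc n) ?s') z - inv (U n s) z) \<le> (3/4)^n" if "z \<in> B" for z
    proof -
      have "M * norm (inv (U n s) z - inv (U n s) z \<star> e i) \<le> (3/4)^n"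
        using i(2)[OF that] M by (simp add: pos_le_divide_eq mult.commute)
      with inv_unitized_rmult_step[OF inv small, of z] show ?thesis
        unfolding U_def by (rule order_trans)
    qed
    ultimately show ?thesis
      using invertible_bound_step[OF inv small]
      by (intro exI[of _ "(?s', 4 * M)"]) (auto simp: P_def Q_def p)
  qed
  obtain p where P: "\<And>n. P n (p n)" and Q: "\<And>n. Q n (p n) (p (Suc n))"
    using dependent_nat_choice[of P Q] init step by metis
  have conv: "convergent f" if "\<And>n. norm (f (Suc n) - f n) \<le> (3/4)^n" for f :: "nat \<Rightarrow> 'a"
  proof -
    have "summable (\<lambda>n. f (Suc n) - f n)"
      by (rule summable_comparison_test'[where g = "\<lambda>n. (3/4)^n" and N = 0])
        (use that in \<open>auto intro: summable_geometric\<close>)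
    then have "convergent (\<lambda>n. f n - f 0)"
      by (simp add: summable_iff_convergent sum_lessThan_telescope)
    from convergent_add[OF this convergent_const[of "f 0"]] show ?thesis
      by simp
  qed
  have "convergent (\<lambda>n. fst (p n))"
    using Q by (intro conv) (simp add: Q_def)
  then obtain a where a: "(\<lambda>n. fst (p n)) \<longlonglongrightarrow> a"
    by (auto simp: convergent_def)
  have "\<exists>z'. z = z' \<star> a" if "z \<in> B" for z
  proof -
    define y where "y n = inv (U n (fst (p n))) z" for n
    have "convergent y"
      using Q that by (intro conv) (simp add: Q_def y_def)
    then obtain z' where z': "y \<longlonglongrightarrow> z'"
      by (auto simp: convergent_def)
    have "U n (fst (p n)) (y n) = z" for n
      using P[of n] by (simp add: P_def invertible_bound_def U_def y_def surj_f_inv_f)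
    then have "(3/4)^n *\<^sub>R y n + y n \<star> fst (p n) = z" for n
      by (simp add: U_def unitized_rmult_def)
    moreover have "(\<lambda>n. (3/4)^n *\<^sub>R y n + y n \<star> fst (p n)) \<longlonglongrightarrow> 0 *\<^sub>R z' + z' \<star> a"
      by (intro tendsto_intros tendsto z' a LIMSEQ_power_zero) auto
    ultimately have "z = 0 *\<^sub>R z' + z' \<star> a"
      by (simp add: LIMSEQ_const_iff)
    then show ?thesis by auto
  qed
  then show thesis by (rule that)
qed

end

subsection \<open>Bounded maps on subspaces of the dual\<close>

lemma norm_dual_scale_le: "norm (dual_scale c x) \<le> norm c * norm x"
proof (rule norm_blinfun_bound)
  show "norm (blinfun_apply (dual_scale c x) v) \<le> norm c * norm x * norm v" for v
    using mult_left_mono[OF norm_blinfun[of x v] norm_ge_zero[of c]]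
    by (simp add: dual_scale.rep_eq norm_mult mult_ac)
qed simp

lemma subspace_dual_space: "dual.subspace (dual_space scl)"
  unfolding dual.subspace_def dual_space_def
  by (auto simp: plus_blinfun.rep_eq dual_scale.rep_eq zero_blinfun.rep_eq algebra_simps)

lemma bounded_linear_over_bound:
  assumes "bounded_linear_over s X f"
  obtains K where "K \<ge> 0" "\<And>x. x \<in> X \<Longrightarrow> norm (f x) \<le> K * norm x"
proof -
  obtain K where K: "\<And>x. x \<in> X \<Longrightarrow> norm (f x) \<le> K * norm x"
    using assms unfolding bounded_linear_over_def by blast
  show thesis
  proof (rule that[of "\<bar>K\<bar>"])
    show "norm (f x) \<le> \<bar>K\<bar> * norm x" if "x \<in> X" for x
      using K[OF that] mult_right_mono[OF abs_ge_self[of K] norm_ge_zero[of x]] by linarith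
  qed simp
qed

lemma bounded_linear_over_diff:
  assumes "bounded_linear_over s X f" "dual.subspace X" "x \<in> X" "y \<in> X"
  shows "f (x - y) = f x - f y"
proof -
  have "f (x - y + y) = f (x - y) + f y"
    using assms(1,4) dual.subspace_diff[OF assms(2-4)] unfolding bounded_linear_over_def by blast
  then show ?thesis by simp
qed

text \<open>At \<open>x = 0\<close> the quotient is 0, as division by zero gives 0;
  \<open>K \<ge> 0\<close> covers this point.\<close>

lemma onorm_on_least:
  assumes "X \<noteq> {}" "K \<ge> 0" "\<And>x. x \<in> X \<Longrightarrow> norm (f x) \<le> K * norm x"
  shows "onorm_on X f \<le> K"
  unfolding onorm_on_def
proof (rule cSUP_least)
  show "norm (f x) / norm x \<le> K" if "x \<in> X" for x
    using assms(2) assms(3)[OF that] by (cases "x = 0") (simp_all add: field_simps)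
qed fact

lemma
  assumes f: "bounded_linear_over s X f" and "dual.subspace X"
  shows norm_le_onorm_on: "x \<in> X \<Longrightarrow> norm (f x) \<le> onorm_on X f * norm x"
    and onorm_on_nonneg: "onorm_on X f \<ge> 0"
proof -
  obtain K where K: "K \<ge> 0" "\<And>x. x \<in> X \<Longrightarrow> norm (f x) \<le> K * norm x"
    using bounded_linear_over_bound[OF f] by metis
  have "bdd_above ((\<lambda>x. norm (f x) / norm x) ` X)"
  proof (rule bdd_aboveI2)
    show "norm (f x) / norm x \<le> K" if "x \<in> X" for x
      using K(1) K(2)[OF that] by (cases "x = 0") (simp_all add: field_simps)
  qed
  then have le: "norm (f x) / norm x \<le> onorm_on X f" if "x \<in> X" for x
    unfolding onorm_on_def using that by (intro cSUP_upper)
  show "norm (f x) \<le> onorm_on X f * norm x" if "x \<in> X"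
    using le[OF that] K(2)[OF that] by (cases "x = 0") (simp_all add: field_simps)
  show "onorm_on X f \<ge> 0"
    using le[OF dual.subspace_0[OF \<open>dual.subspace X\<close>]] by simp
qed

section \<open>Opposite algebras and inverse isomorphisms\<close>

definition opposite_alg :: "('k, 'b) normed_alg \<Rightarrow> ('k, 'b) normed_alg" where
  "opposite_alg P = P\<lparr>mul := \<lambda>a b. mul P b a\<rparr>"

text \<open>For the left-module statements: \<open>Hl\<close> and \<open>right_dual_alg\<close> both
  reverse the products that the flipped multiplication produces.\<close>

lemma isometric_alg_iso_opposite: "P \<cong>\<^sub>i Q \<Longrightarrow> opposite_alg P \<cong>\<^sub>i opposite_alg Q"
  unfolding isometric_alg_iso_def opposite_alg_def by auto

text \<open>Carriers come without closure properties, so closure of \<open>P\<close> is assumed: the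
  inverse cancels \<open>\<phi>\<close> on a sum or product only if that lies in the
  carrier.\<close>

lemma isometric_alg_iso_sym:
  assumes "P \<cong>\<^sub>i Q"
    and add: "\<And>a b. a \<in> car P \<Longrightarrow> b \<in> car P \<Longrightarrow> add P a b \<in> car P"
    and smul: "\<And>c a. a \<in> car P \<Longrightarrow> smul P c a \<in> car P"
    and mul: "\<And>a b. a \<in> car P \<Longrightarrow> b \<in> car P \<Longrightarrow> mul P a b \<in> car P"
  shows "Q \<cong>\<^sub>i P"
proof -
  obtain \<phi> where bij: "bij_betw \<phi> (car P) (car Q)"
    and hom: "\<And>a b. a \<in> car P \<Longrightarrow> b \<in> car P \<Longrightarrow> \<phi> (add P a b) = add Q (\<phi> a) (\<phi> b)"
      "\<And>c a. a \<in> car P \<Longrightarrow> \<phi> (smul P c a) = smul Q c (\<phi> a)"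
      "\<And>a b. a \<in> car P \<Longrightarrow> b \<in> car P \<Longrightarrow> \<phi> (mul P a b) = mul Q (\<phi> a) (\<phi> b)"
      "\<And>a. a \<in> car P \<Longrightarrow> nrm Q (\<phi> a) = nrm P a"
    using assms(1) by (auto simp: isometric_alg_iso_def)
  define \<psi> where "\<psi> = inv_into (car P) \<phi>"
  have mem: "\<psi> b \<in> car P" and right: "\<phi> (\<psi> b) = b" if "b \<in> car Q" for b
    using that bij by (auto simp: \<psi>_def bij_betw_def inv_into_into f_inv_into_f)
  have left: "\<psi> (\<phi> a) = a" if "a \<in> car P" for a
    using that bij by (auto simp: \<psi>_def bij_betw_def)
  have "bij_betw \<psi> (car Q) (car P)"
    unfolding \<psi>_def using bij by (rule bij_betw_inv_into)
  moreover have "\<psi> (add Q a b) = add P (\<psi> a) (\<psi> b)" "\<psi> (mul Q a b) = mul P (\<psi> a) (\<psi> b)"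
    if "a \<in> car Q" "b \<in> car Q" for a b
    using left[OF add[OF mem[OF that(1)] mem[OF that(2)]]] left[OF mul[OF mem[OF that(1)] mem[OF that(2)]]]
      that by (simp_all add: hom mem right)
  moreover have "\<psi> (smul Q c a) = smul P c (\<psi> a)" if "a \<in> car Q" for c a
    using left[OF smul[OF mem[OF that]]] that by (simp add: hom mem right)
  moreover have "nrm P (\<psi> b) = nrm Q b" if "b \<in> car Q" for b
    using hom(4)[OF mem[OF that]] right[OF that] by simp
  ultimately show ?thesis
    unfolding isometric_alg_iso_def by (intro exI[of _ \<psi>]) auto
qed

subsection \<open>Module maps and functionals\<close>

text \<open>
  Instantiated with the product of the algebra and with its opposite, this locale yields the
  statements on right and on left module maps respectively.
\<close>

locale dual_action = approx_unital_product prod e F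
  for prod :: "'a::{real_normed_algebra,banach} \<Rightarrow> 'a \<Rightarrow> 'a" (infixl "\<star>" 70)
    and e :: "'i \<Rightarrow> 'a" and F :: "'i filter" +
  fixes scl :: "'k::{real_normed_field,banach} \<Rightarrow> 'a \<Rightarrow> 'a"
    and act :: "('a \<Rightarrow>\<^sub>L 'k) \<Rightarrow> 'a \<Rightarrow> ('a \<Rightarrow>\<^sub>L 'k)" (infixl "\<triangleleft>" 70)
  assumes scl_prod: "scl c a \<star> b = scl c (a \<star> b)"
    and prod_scl: "a \<star> scl c b = scl c (a \<star> b)"
    and apply_act: "blinfun_apply (x \<triangleleft> a) b = blinfun_apply x (a \<star> b)"
begin

lemma act_act: "x \<triangleleft> a \<triangleleft> b = x \<triangleleft> (a \<star> b)"
  by (rule blinfun_eqI) (simp add: apply_act assoc)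

lemma norm_act_le: "norm (x \<triangleleft> a) \<le> norm x * norm a"
proof (rule norm_blinfun_bound)
  show "norm (blinfun_apply (x \<triangleleft> a) b) \<le> norm x * norm a * norm b" for b
    using norm_blinfun[of x "a \<star> b"] mult_left_mono[OF norm_prod_le[of a b] norm_ge_zero[of x]]
    by (simp add: apply_act mult_ac)
qed simp

lemma act_add_right: "x \<triangleleft> (a + b) = x \<triangleleft> a + x \<triangleleft> b"
  and act_scaleR_right: "x \<triangleleft> (r *\<^sub>R a) = r *\<^sub>R (x \<triangleleft> a)"
  and act_add_left: "(x + y) \<triangleleft> a = x \<triangleleft> a + y \<triangleleft> a"
  and act_dual_scale: "dual_scale c x \<triangleleft> a = dual_scale c (x \<triangleleft> a)"
  by (rule blinfun_eqI; simp add: apply_act add_left scaleR_left blinfun.bilinear_simps dual_scale.rep_eq)+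

lemma act_scl: "x \<in> dual_space scl \<Longrightarrow> x \<triangleleft> scl c a = dual_scale c (x \<triangleleft> a)"
  by (rule blinfun_eqI) (simp add: apply_act scl_prod dual_space_def dual_scale.rep_eq)

lemma bounded_linear_act: "bounded_linear (\<lambda>a. x \<triangleleft> a)"
  by (rule bounded_linear_intro[where K = "norm x"])
    (simp_all add: act_add_right act_scaleR_right norm_act_le mult.commute[of "norm _" "norm x"])

lemma act_in_dual_space: "x \<in> dual_space scl \<Longrightarrow> x \<triangleleft> a \<in> dual_space scl"
  by (simp add: dual_space_def apply_act prod_scl)

section \<open>The subspace \<open>A\<^sup>* \<cdot> A\<close>\<close>

definition dual_dot :: "('a \<Rightarrow>\<^sub>L 'k) set" where
  "dual_dot = {x \<triangleleft> a | x a. x \<in> dual_space scl}"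

lemma act_in_dual_dot: "x \<in> dual_space scl \<Longrightarrow> x \<triangleleft> a \<in> dual_dot"
  by (auto simp: dual_dot_def)

lemma dual_dotE:
  assumes "z \<in> dual_dot"
  obtains y a where "y \<in> dual_space scl" "z = y \<triangleleft> a"
  using assms by (auto simp: dual_dot_def)

lemma dual_dot_subset: "dual_dot \<subseteq> dual_space scl"
  by (auto simp: dual_dot_def act_in_dual_space)

lemma subspace_dual_dot: "dual.subspace dual_dot"
proof (rule dual.subspaceI)
  have "(0 :: 'a \<Rightarrow>\<^sub>L 'k) = 0 \<triangleleft> 0"
    by (rule blinfun_eqI) (simp add: apply_act)
  then show "0 \<in> dual_dot"
    using act_in_dual_dot[OF dual.subspace_0[OF subspace_dual_space]] by metis
next
  fix z1 z2 assume "z1 \<in> dual_dot" "z2 \<in> dual_dot"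
  then obtain y1 a1 y2 a2 where z: "z1 = y1 \<triangleleft> a1" "z2 = y2 \<triangleleft> a2"
    and y: "y1 \<in> dual_space scl" "y2 \<in> dual_space scl"
    by (metis dual_dotE)
  obtain a where a: "\<And>b. b \<in> {a1, a2} \<Longrightarrow> \<exists>b'. b = b' \<star> a"
    using finite_common_right_factor[of "{a1, a2}"] by blast
  obtain b1 b2 where "a1 = b1 \<star> a" "a2 = b2 \<star> a"
    using a[of a1] a[of a2] by auto
  then have "z1 + z2 = (y1 \<triangleleft> b1 + y2 \<triangleleft> b2) \<triangleleft> a"
    by (simp add: z act_add_left act_act)
  moreover have "y1 \<triangleleft> b1 + y2 \<triangleleft> b2 \<in> dual_space scl"
    by (intro dual.subspace_add[OF subspace_dual_space] act_in_dual_space y)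
  ultimately show "z1 + z2 \<in> dual_dot"
    by (simp add: act_in_dual_dot)
next
  fix c z assume "z \<in> dual_dot"
  then obtain y a where "z = y \<triangleleft> a" "y \<in> dual_space scl"
    by (metis dual_dotE)
  then show "dual_scale c z \<in> dual_dot"
    using act_in_dual_dot[OF dual.subspace_scale[OF subspace_dual_space]]
    by (metis act_dual_scale)
qed

definition odot :: "(('a \<Rightarrow>\<^sub>L 'k) \<Rightarrow> 'k) \<Rightarrow> ('a \<Rightarrow>\<^sub>L 'k) \<Rightarrow> ('a \<Rightarrow>\<^sub>L 'k)" where
  "odot m x = Blinfun (\<lambda>a. m (x \<triangleleft> a))"

lemma odot_apply:
  assumes "m \<in> functionals Y" "\<And>a. x \<triangleleft> a \<in> Y"
  shows "blinfun_apply (odot m x) a = m (x \<triangleleft> a)"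
  unfolding odot_def
  by (subst bounded_linear_Blinfun_apply)
    (auto intro: functional_compose_bounded_linear[OF assms(1) bounded_linear_act assms(2)])

text \<open>Linearity over \<open>'k\<close> holds because \<open>act_scl\<close> turns a scalar on
  the algebra into one on the dual, which \<open>m\<close> respects.\<close>

lemma odot_in_dual_space:
  assumes m: "m \<in> functionals Y" and x: "x \<in> dual_space scl" "\<And>a. x \<triangleleft> a \<in> Y"
  shows "odot m x \<in> dual_space scl"
  using m x(2) unfolding dual_space_def mem_Collect_eq odot_apply[OF m x(2)] act_scl[OF x(1)]
  by (simp add: functionals_def bounded_linear_over_def)

section \<open>Algebras of module maps and of functionals\<close>

definition module_maps :: "('a \<Rightarrow>\<^sub>L 'k) set \<Rightarrow> (('a \<Rightarrow>\<^sub>L 'k) \<Rightarrow> ('a \<Rightarrow>\<^sub>L 'k)) set" where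
  "module_maps X =
     {T \<in> X \<rightarrow>\<^sub>E X. bounded_linear_over dual_scale X T \<and> (\<forall>x\<in>X. \<forall>a. T (x \<triangleleft> a) = T x \<triangleleft> a)}"

definition module_map_alg ::
    "('a \<Rightarrow>\<^sub>L 'k) set \<Rightarrow> ('k, ('a \<Rightarrow>\<^sub>L 'k) \<Rightarrow> ('a \<Rightarrow>\<^sub>L 'k)) normed_alg" where
  "module_map_alg X =
     \<lparr> car = module_maps X,
       add = (\<lambda>S T. \<lambda>x\<in>X. S x + T x),
       smul = (\<lambda>c T. \<lambda>x\<in>X. dual_scale c (T x)),
       mul = (\<lambda>S T. \<lambda>x\<in>X. S (T x)),
       nrm = onorm_on X \<rparr>"

definition dual_alg :: "('a \<Rightarrow>\<^sub>L 'k) set \<Rightarrow> ('k, ('a \<Rightarrow>\<^sub>L 'k) \<Rightarrow> 'k) normed_alg" where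
  "dual_alg X =
     \<lparr> car = functionals X,
       add = (\<lambda>m n. \<lambda>x\<in>X. m x + n x),
       smul = (\<lambda>c m. \<lambda>x\<in>X. c * m x),
       mul = (\<lambda>m n. \<lambda>x\<in>X. m (odot n x)),
       nrm = onorm_on X \<rparr>"

lemma module_mapsD:
  assumes "T \<in> module_maps X"
  shows "bounded_linear_over dual_scale X T" "x \<in> X \<Longrightarrow> T x \<in> X" "T \<in> extensional X"
    "x \<in> X \<Longrightarrow> T (x \<triangleleft> a) = T x \<triangleleft> a"
    "x \<in> X \<Longrightarrow> y \<in> X \<Longrightarrow> T (x + y) = T x + T y"
    "x \<in> X \<Longrightarrow> T (dual_scale c x) = dual_scale c (T x)"
  using assms by (auto simp: module_maps_def bounded_linear_over_def PiE_def)

text \<open>These are the closure conditions that \<open>isometric_alg_iso_sym\<close> asks of an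
  algebra of module maps.\<close>

lemma
  assumes X: "dual.subspace X" "\<And>x a. x \<in> X \<Longrightarrow> x \<triangleleft> a \<in> X"
    and S: "S \<in> module_maps X"
  shows module_maps_add: "T \<in> module_maps X \<Longrightarrow> (\<lambda>x\<in>X. S x + T x) \<in> module_maps X"
    and module_maps_scale: "(\<lambda>x\<in>X. dual_scale c (S x)) \<in> module_maps X"
    and module_maps_comp: "T \<in> module_maps X \<Longrightarrow> (\<lambda>x\<in>X. S (T x)) \<in> module_maps X"
proof -
  note Xs = dual.subspace_add[OF X(1)] dual.subspace_scale[OF X(1)]
  obtain K where K: "K \<ge> 0" "\<And>x. x \<in> X \<Longrightarrow> norm (S x) \<le> K * norm x"
    using bounded_linear_over_bound[OF module_mapsD(1)[OF S]] by metis
  have "norm (dual_scale c (S x)) \<le> norm c * K * norm x" if "x \<in> X" for x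
    using norm_dual_scale_le[of c "S x"] mult_left_mono[OF K(2)[OF that] norm_ge_zero[of c]]
    by (simp add: mult_ac)
  then have "\<exists>L. \<forall>x\<in>X. norm (dual_scale c (S x)) \<le> L * norm x"
    by blast
  then show "(\<lambda>x\<in>X. dual_scale c (S x)) \<in> module_maps X"
    unfolding module_maps_def bounded_linear_over_def
    by (auto simp: module_mapsD[OF S] Xs X(2) act_dual_scale dual.scale_right_distrib mult.commute)
  assume T: "T \<in> module_maps X"
  obtain L where L: "\<And>x. x \<in> X \<Longrightarrow> norm (T x) \<le> L * norm x"
    using bounded_linear_over_bound[OF module_mapsD(1)[OF T]] by metis
  have "norm (S x + T x) \<le> (K + L) * norm x" if "x \<in> X" for x
    using norm_triangle_ineq[of "S x" "T x"] K(2)[OF that] L[OF that] by (simp add: distrib_right)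
  then have "\<exists>L. \<forall>x\<in>X. norm (S x + T x) \<le> L * norm x"
    by blast
  then show "(\<lambda>x\<in>X. S x + T x) \<in> module_maps X"
    unfolding module_maps_def bounded_linear_over_def
    by (auto simp: module_mapsD[OF S] module_mapsD[OF T] Xs X(2) act_add_left dual.scale_right_distrib)
  have "norm (S (T x)) \<le> K * L * norm x" if "x \<in> X" for x
    using K(2)[OF module_mapsD(2)[OF T that]] mult_left_mono[OF L[OF that] K(1)]
    by (simp add: mult_ac)
  then have "\<exists>L. \<forall>x\<in>X. norm (S (T x)) \<le> L * norm x"
    by blast
  then show "(\<lambda>x\<in>X. S (T x)) \<in> module_maps X"
    unfolding module_maps_def bounded_linear_over_def
    by (auto simp: module_mapsD[OF S] module_mapsD[OF T] Xs X(2))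
qed

section \<open>Evaluation along the approximate identity\<close>

definition limit_eval :: "('a \<Rightarrow>\<^sub>L 'k) \<Rightarrow> 'k" where
  "limit_eval z = Lim F (\<lambda>i. blinfun_apply z (e i))"

lemma tendsto_apply_e: "((\<lambda>i. blinfun_apply (y \<triangleleft> a) (e i)) \<longlongrightarrow> blinfun_apply y a) F"
  unfolding apply_act by (intro blinfun.tendsto tendsto_const tendsto_prod_e)

text \<open>As the left side mentions only the product \<open>y \<triangleleft> a\<close>, the value
  \<open>y a\<close> does not depend on the factorization.\<close>

lemma limit_eval_act [simp]: "limit_eval (y \<triangleleft> a) = blinfun_apply y a"
  unfolding limit_eval_def using F_nontrivial tendsto_apply_e by (rule tendsto_Lim)

lemma tendsto_limit_eval:
  assumes "z \<in> dual_dot"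
  shows "((\<lambda>i. blinfun_apply z (e i)) \<longlongrightarrow> limit_eval z) F"
  using assms tendsto_apply_e by (auto elim!: dual_dotE)

lemma limit_eval_add:
  assumes "z \<in> dual_dot" "z' \<in> dual_dot"
  shows "limit_eval (z + z') = limit_eval z + limit_eval z'"
  unfolding limit_eval_def[of "z + z'"] blinfun.add_left
  using F_nontrivial by (intro tendsto_Lim tendsto_add tendsto_limit_eval assms)

lemma limit_eval_scale:
  assumes "z \<in> dual_dot"
  shows "limit_eval (dual_scale c z) = c * limit_eval z"
  unfolding limit_eval_def[of "dual_scale c z"] dual_scale.rep_eq
  using F_nontrivial by (intro tendsto_Lim tendsto_mult_left tendsto_limit_eval assms)

text \<open>The bound one on the approximate identity gives the constant 1 here, which makes the
  final isomorphism isometric and not merely bicontinuous.\<close>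

lemma norm_limit_eval_le:
  assumes "z \<in> dual_dot"
  shows "norm (limit_eval z) \<le> norm z"
proof (rule tendsto_upperbound[OF tendsto_norm[OF tendsto_limit_eval[OF assms]] _ F_nontrivial])
  have "norm (blinfun_apply z (e i)) \<le> norm z" for i
    using norm_blinfun[of z "e i"] mult_left_mono[OF norm_e_le[of i] norm_ge_zero[of z]] by simp
  then show "\<forall>\<^sub>F i in F. norm (blinfun_apply z (e i)) \<le> norm z"
    by simp
qed

text \<open>
  The cases of interest are \<open>X = Y\<close>, and \<open>X\<close> the full dual space with \<open>Y\<close> equal to \<open>dual_dot\<close>.
\<close>

lemma module_map_alg_iso_dual_alg:
  assumes X: "dual.subspace X"
    and Y: "dual.subspace Y" "Y \<subseteq> X" "Y \<subseteq> dual_dot"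
    and act_Y: "\<And>x a. x \<in> X \<Longrightarrow> x \<triangleleft> a \<in> Y"
    and odot_X: "\<And>m x. m \<in> functionals Y \<Longrightarrow> x \<in> X \<Longrightarrow> odot m x \<in> X"
    and map_Y: "\<And>T x. T \<in> module_maps X \<Longrightarrow> x \<in> Y \<Longrightarrow> T x \<in> Y"
  shows "module_map_alg X \<cong>\<^sub>i dual_alg Y"
proof -
  define \<phi> where "\<phi> T = (\<lambda>x\<in>Y. limit_eval (T x))" for T
  define \<psi> where "\<psi> m = (\<lambda>x\<in>X. odot m x)" for m
  have \<phi>_apply: "\<phi> T x = limit_eval (T x)" if "x \<in> Y" for T x
    using that by (simp add: \<phi>_def)
  have YX: "x \<in> X" if "x \<in> Y" for x
    using that Y(2) by blast
  have T_dual_dot: "T x \<in> dual_dot" if "T \<in> module_maps X" "x \<in> Y" for T x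
    using map_Y[OF that] Y(3) by blast
  note Y_closed = dual.subspace_add[OF Y(1)] dual.subspace_scale[OF Y(1)]
  have \<phi>_mem: "\<phi> T \<in> functionals Y" if T: "T \<in> module_maps X" for T
  proof -
    obtain K where K: "\<And>x. x \<in> X \<Longrightarrow> norm (T x) \<le> K * norm x"
      using bounded_linear_over_bound[OF module_mapsD(1)[OF T]] by metis
    have "norm (\<phi> T x) \<le> K * norm x" if "x \<in> Y" for x
      using norm_limit_eval_le[OF T_dual_dot[OF T that]] K[OF YX[OF that]]
      by (simp add: \<phi>_apply that)
    then have "\<exists>K. \<forall>x\<in>Y. norm (\<phi> T x) \<le> K * norm x"
      by blast
    then show ?thesis
      unfolding functionals_def bounded_linear_over_def mem_Collect_eq
      by (auto simp: \<phi>_def Y_closed module_mapsD[OF T] YX T_dual_dot[OF T] limit_eval_add limit_eval_scale)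
  qed
  \<comment> \<open>At \<open>a\<close> the left side is the limit evaluation of
    \<open>T (x \<triangleleft> a) = T x \<triangleleft> a\<close>. Since
    \<open>x \<triangleleft> a\<close> lies in \<open>Y\<close> for every \<open>x\<close> in
    \<open>X\<close>, the values of \<open>T\<close> on \<open>Y\<close> recover \<open>T\<close> on
    all of \<open>X\<close>.\<close>
  have odot_\<phi>: "odot (\<phi> T) x = T x" if T: "T \<in> module_maps X" and x: "x \<in> X" for T x
    by (rule blinfun_eqI)
      (simp add: odot_apply[OF \<phi>_mem[OF T] act_Y[OF x]] \<phi>_apply act_Y[OF x] module_mapsD(4)[OF T x])
  have functional_bound: "norm (odot m x) \<le> onorm_on Y m * norm x"
    if m: "m \<in> functionals Y" and x: "x \<in> X" for m x
  proof (rule norm_blinfun_bound)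
    have m': "bounded_linear_over (*) Y m"
      using m by (simp add: functionals_def)
    show "norm (blinfun_apply (odot m x) a) \<le> onorm_on Y m * norm x * norm a" for a
      using norm_le_onorm_on[OF m' Y(1) act_Y[OF x, of a]]
        mult_left_mono[OF norm_act_le[of x a] onorm_on_nonneg[OF m' Y(1)]]
      by (simp add: odot_apply[OF m act_Y[OF x]] mult_ac)
    show "0 \<le> onorm_on Y m * norm x"
      using onorm_on_nonneg[OF m' Y(1)] by simp
  qed
  have \<psi>_mem: "\<psi> m \<in> module_maps X" if m: "m \<in> functionals Y" for m
  proof -
    have m_lin: "m (x + y) = m x + m y" "m (dual_scale c x) = c * m x" if "x \<in> Y" "y \<in> Y" for c x y
      using m that by (auto simp: functionals_def bounded_linear_over_def)
    have "odot m (x + y) = odot m x + odot m y" if "x \<in> X" "y \<in> X" for x y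
      using that dual.subspace_add[OF X that]
      by (intro blinfun_eqI) (simp add: odot_apply[OF m act_Y] blinfun.add_left act_add_left m_lin act_Y)
    moreover have "odot m (dual_scale c x) = dual_scale c (odot m x)" if "x \<in> X" for c x
      using that dual.subspace_scale[OF X that, of c]
      by (intro blinfun_eqI)
        (simp add: odot_apply[OF m act_Y] dual_scale.rep_eq act_dual_scale m_lin(2)[OF act_Y act_Y])
    moreover have "odot m (x \<triangleleft> a) = odot m x \<triangleleft> a" if "x \<in> X" for x a
      using that YX[OF act_Y[OF that, of a]]
      by (intro blinfun_eqI) (simp add: odot_apply[OF m act_Y] apply_act act_act)
    moreover have "\<exists>K. \<forall>x\<in>X. norm (odot m x) \<le> K * norm x"
      using functional_bound[OF m] by blast
    ultimately show ?thesis
      using odot_X[OF m]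
      unfolding module_maps_def bounded_linear_over_def
      by (auto simp: \<psi>_def X dual.subspace_add dual.subspace_scale YX act_Y)
  qed
  have \<psi>_\<phi>: "\<psi> (\<phi> T) = T" if T: "T \<in> module_maps X" for T
    by (rule extensionalityI[of _ X]) (simp_all add: \<psi>_def odot_\<phi>[OF T] module_mapsD(3)[OF T])
  have \<phi>_\<psi>: "\<phi> (\<psi> m) = m" if m: "m \<in> functionals Y" for m
  proof (rule extensionalityI[of _ Y])
    fix x assume x: "x \<in> Y"
    then obtain y a where y: "y \<in> dual_space scl" "x = y \<triangleleft> a"
      using Y(3) by (blast elim: dual_dotE)
    have m': "bounded_linear_over (*) Y m"
      using m by (simp add: functionals_def)
    then obtain K where K: "\<And>x. x \<in> Y \<Longrightarrow> norm (m x) \<le> K * norm x"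
      using bounded_linear_over_bound by metis
    \<comment> \<open>The factorization of \<open>x\<close> turns
      \<open>a \<star> e i \<longlongrightarrow> a\<close> into norm convergence of
      \<open>x \<triangleleft> e i\<close> to \<open>x\<close>.\<close>
    have "((\<lambda>i. y \<triangleleft> (a \<star> e i)) \<longlongrightarrow> y \<triangleleft> a) F"
      by (rule bounded_linear.tendsto[OF bounded_linear_act tendsto_prod_e])
    then have "((\<lambda>i. x \<triangleleft> e i - x) \<longlongrightarrow> 0) F"
      unfolding y(2) act_act by (subst (asm) LIM_zero_iff[symmetric])
    \<comment> \<open>\<open>m\<close> is bounded only on \<open>Y\<close>, so its continuity is
      used through differences, which stay in the subspace \<open>Y\<close>.\<close>
    then have "((\<lambda>i. m (x \<triangleleft> e i - x)) \<longlongrightarrow> 0) F"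
    proof (rule tendsto_0_le[where K = K])
      show "\<forall>\<^sub>F i in F. norm (m (x \<triangleleft> e i - x)) \<le> norm (x \<triangleleft> e i - x) * K"
        using K[OF dual.subspace_diff[OF Y(1) act_Y[OF YX[OF x]] x]] by (simp add: mult.commute)
    qed
    then have "((\<lambda>i. blinfun_apply (odot m x) (e i) - m x) \<longlongrightarrow> 0) F"
      by (simp add: bounded_linear_over_diff[OF m' Y(1) act_Y[OF YX[OF x]] x]
          odot_apply[OF m act_Y[OF YX[OF x]]])
    then have "limit_eval (odot m x) = m x"
      unfolding limit_eval_def using F_nontrivial by (intro tendsto_Lim) (simp_all add: LIM_zero_iff)
    then show "\<phi> (\<psi> m) x = m x"
      using x YX[OF x] by (simp add: \<phi>_def \<psi>_def)
  qed (use m in \<open>auto simp: \<phi>_def functionals_def\<close>)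
  have "bij_betw \<phi> (module_maps X) (functionals Y)"
    by (rule bij_betw_byWitness[where f' = \<psi>]) (auto simp: \<phi>_\<psi> \<psi>_\<phi> \<phi>_mem \<psi>_mem)
  moreover have "\<phi> (\<lambda>x\<in>X. S x + T x) = (\<lambda>x\<in>Y. \<phi> S x + \<phi> T x)"
    if "S \<in> module_maps X" "T \<in> module_maps X" for S T
    unfolding \<phi>_def using that YX by (intro restrict_ext) (simp add: limit_eval_add T_dual_dot)
  moreover have "\<phi> (\<lambda>x\<in>X. dual_scale c (T x)) = (\<lambda>x\<in>Y. c * \<phi> T x)"
    if "T \<in> module_maps X" for c T
    unfolding \<phi>_def using that YX by (intro restrict_ext) (simp add: limit_eval_scale T_dual_dot)
  \<comment> \<open>By \<open>odot_\<phi>\<close> the inner term is \<open>T x\<close>, and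
    \<open>map_Y\<close> keeps it in \<open>Y\<close>, where \<open>\<phi> S\<close> is the limit
    evaluation of \<open>S\<close>.\<close>
  moreover have "\<phi> (\<lambda>x\<in>X. S (T x)) = (\<lambda>x\<in>Y. \<phi> S (odot (\<phi> T) x))"
    if "S \<in> module_maps X" "T \<in> module_maps X" for S T
    using that YX by (subst \<phi>_def, intro restrict_ext) (simp add: odot_\<phi> \<phi>_apply map_Y)
  moreover have "onorm_on Y (\<phi> T) = onorm_on X T" if T: "T \<in> module_maps X" for T
  proof (rule antisym)
    note T' = module_mapsD(1)[OF T]
    have "\<phi> T \<in> functionals Y"
      using T by (rule \<phi>_mem)
    then have "bounded_linear_over (*) Y (\<phi> T)"
      by (simp add: functionals_def)
    \<comment> \<open>On \<open>X\<close> the map \<open>T\<close> equals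
      \<open>odot (\<phi> T)\<close>, so the bound for \<open>odot\<close> applies to
      \<open>T\<close>.\<close>
    from onorm_on_nonneg[OF this Y(1)] show "onorm_on X T \<le> onorm_on Y (\<phi> T)"
      using functional_bound[OF \<phi>_mem[OF T]] dual.subspace_0[OF X]
      by (intro onorm_on_least) (auto simp: odot_\<phi>[OF T])
    show "onorm_on Y (\<phi> T) \<le> onorm_on X T"
    proof (rule onorm_on_least)
      show "norm (\<phi> T x) \<le> onorm_on X T * norm x" if "x \<in> Y" for x
        using norm_limit_eval_le[OF T_dual_dot[OF T that]] norm_le_onorm_on[OF T' X YX[OF that]]
        by (simp add: \<phi>_apply that)
    qed (use dual.subspace_0[OF Y(1)] onorm_on_nonneg[OF T' X] in auto)
  qed
  ultimately show ?thesis
    unfolding isometric_alg_iso_def module_map_alg_def dual_alg_def normed_alg.simps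
    by (intro exI[of _ \<phi>]) blast
qed

theorem introverted_iso:
  assumes "dual.subspace X" "X \<subseteq> dual_dot"
    and "\<And>x a. x \<in> X \<Longrightarrow> x \<triangleleft> a \<in> X"
    and "\<And>m x. m \<in> functionals X \<Longrightarrow> x \<in> X \<Longrightarrow> odot m x \<in> X"
  shows "module_map_alg X \<cong>\<^sub>i dual_alg X"
  using assms by (intro module_map_alg_iso_dual_alg) (auto simp: module_mapsD)

theorem dual_space_iso: "module_map_alg (dual_space scl) \<cong>\<^sub>i dual_alg dual_dot"
proof (rule module_map_alg_iso_dual_alg)
  show "odot m x \<in> dual_space scl" if "m \<in> functionals dual_dot" "x \<in> dual_space scl" for m x
    using that by (auto intro: odot_in_dual_space act_in_dual_dot)
  show "T x \<in> dual_dot" if "T \<in> module_maps (dual_space scl)" "x \<in> dual_dot" for T x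
    using that by (auto elim!: dual_dotE simp: module_mapsD act_in_dual_dot)
qed (auto intro: subspace_dual_space subspace_dual_dot act_in_dual_dot act_in_dual_space elim!: dual_dotE)

text \<open>The subspace \<open>dual_dot\<close> is itself introverted, so
  \<open>introverted_iso\<close> applies to it and is then inverted.\<close>

theorem dual_dot_iso: "dual_alg dual_dot \<cong>\<^sub>i module_map_alg dual_dot"
proof (rule isometric_alg_iso_sym)
  have act: "x \<triangleleft> a \<in> dual_dot" if "x \<in> dual_dot" for x a
    using that dual_dot_subset by (blast intro: act_in_dual_dot)
  have "odot m x \<in> dual_dot" if m: "m \<in> functionals dual_dot" and "x \<in> dual_dot" for m x
  proof -
    obtain y a where y: "y \<in> dual_space scl" and x: "x = y \<triangleleft> a"
      using \<open>x \<in> dual_dot\<close> by (rule dual_dotE)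
    \<comment> \<open>Although \<open>y\<close> need not lie in \<open>dual_dot\<close>, every
      \<open>y \<triangleleft> b\<close> does, so \<open>odot m y\<close> is a genuine functional,
      and the factor \<open>a\<close> of \<open>x\<close> can be pulled out.\<close>
    have "odot m x = odot m y \<triangleleft> a"
      unfolding x using act_in_dual_dot[OF y] act
      by (intro blinfun_eqI) (simp add: odot_apply[OF m] apply_act act_act)
    then show ?thesis
      using odot_in_dual_space[OF m y act_in_dual_dot[OF y]] by (simp add: act_in_dual_dot)
  qed
  then show "module_map_alg dual_dot \<cong>\<^sub>i dual_alg dual_dot"
    using act by (intro introverted_iso subspace_dual_dot) auto
qed (auto simp: module_map_alg_def
    intro: module_maps_add module_maps_scale module_maps_comp subspace_dual_dot
      act_in_dual_dot subsetD[OF dual_dot_subset])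

end

section \<open>Specialization to the multiplication and its opposite\<close>

theorem corollary2p3:
  fixes scl :: "'k::{real_normed_field,banach} \<Rightarrow> 'a::{real_normed_algebra,banach} \<Rightarrow> 'a"
    and e :: "'i \<Rightarrow> 'a" and F :: "'i filter"
  assumes "banach_algebra_over scl"
    and "approx_identity_bounded_by_one e F"
  shows "(\<forall>X. left_introverted scl X \<and> X \<subseteq> dual_dot_alg scl \<longrightarrow> Hr X \<cong>\<^sub>i left_dual_alg X) \<and>
    (\<forall>X. right_introverted scl X \<and> X \<subseteq> alg_dot_dual scl \<longrightarrow> Hl X \<cong>\<^sub>i right_dual_alg X) \<and>
    (Hr (dual_space scl) \<cong>\<^sub>i left_dual_alg (dual_dot_alg scl) \<and>
     left_dual_alg (dual_dot_alg scl) \<cong>\<^sub>i Hr (dual_dot_alg scl)) \<and>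
    (Hl (dual_space scl) \<cong>\<^sub>i right_dual_alg (alg_dot_dual scl) \<and>
     right_dual_alg (alg_dot_dual scl) \<cong>\<^sub>i Hl (alg_dot_dual scl))"
proof -
  interpret banach_algebra_over scl by fact
  have e: "F \<noteq> bot" "\<And>i. norm (e i) \<le> 1"
    "\<And>a. ((\<lambda>i. e i * a) \<longlongrightarrow> a) F" "\<And>a. ((\<lambda>i. a * e i) \<longlongrightarrow> a) F"
    using assms(2) by (auto simp: approx_identity_bounded_by_one_def)
  interpret R: dual_action "(*)" e F scl "(\<cdot>\<^sub>r)"
    by (intro dual_action.intro approx_unital_product.intro approx_unital_product_axioms.intro
        dual_action_axioms.intro bounded_bilinear_mult e mult.assoc norm_mult_ineq
        scale_mult_left scale_mult_right) (simp add: dual_ract.rep_eq)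
  have norm_mult_flip: "norm (b * a) \<le> norm a * norm b" for a b :: 'a
    using norm_mult_ineq[of b a] by (simp add: mult.commute)
  \<comment> \<open>For the flipped product the required convergence is
    \<open>e i * a \<longlongrightarrow> a\<close>, and the left action obeys the law of a right
    action.\<close>
  interpret L: dual_action "\<lambda>a b. b * a" e F scl "\<lambda>x w. w \<cdot>\<^sub>l x"
    by (intro dual_action.intro approx_unital_product.intro approx_unital_product_axioms.intro
        dual_action_axioms.intro bounded_bilinear.flip[OF bounded_bilinear_mult] e
        mult.assoc[symmetric] norm_mult_flip scale_mult_left scale_mult_right)
      (simp add: dual_lact.rep_eq)
  have odot: "R.odot m x = m \<odot> x" "L.odot m x = x \<diamond> m" for m x
    by (simp_all add: R.odot_def functional_odot_def L.odot_def functional_diamond_def)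
  have R: "R.dual_dot = dual_dot_alg scl" "R.module_map_alg = Hr" "R.dual_alg = left_dual_alg"
    by (simp_all add: fun_eq_iff R.dual_dot_def dual_dot_alg_def R.module_map_alg_def Hr_def
        R.module_maps_def right_module_maps_def R.dual_alg_def left_dual_alg_def odot)
  have L: "L.dual_dot = alg_dot_dual scl" "opposite_alg (L.module_map_alg X) = Hl X"
    "opposite_alg (L.dual_alg X) = right_dual_alg X" for X
    by (auto simp: L.dual_dot_def alg_dot_dual_def L.module_map_alg_def Hl_def opposite_alg_def
        L.module_maps_def left_module_maps_def L.dual_alg_def right_dual_alg_def odot)
  have "Hr X \<cong>\<^sub>i left_dual_alg X" if "left_introverted scl X" "X \<subseteq> dual_dot_alg scl" for X
    using R.introverted_iso[unfolded R odot, of X] that by (auto simp: left_introverted_def)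
  moreover have "Hl X \<cong>\<^sub>i right_dual_alg X" if "right_introverted scl X" "X \<subseteq> alg_dot_dual scl" for X
    using isometric_alg_iso_opposite[OF L.introverted_iso, unfolded L odot, of X] that
    by (auto simp: right_introverted_def)
  ultimately show ?thesis
    using R.dual_space_iso R.dual_dot_iso
      isometric_alg_iso_opposite[OF L.dual_space_iso] isometric_alg_iso_opposite[OF L.dual_dot_iso]
    unfolding R L by blast
qed

end
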